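(* Let $0\le M\le N_s$ and let $$|\Psi_M\rangle=\frac{1}{M!\sqrt{\binom{N_s}{M}}}\Big(\sum_{\bm R}q_{\bm R}^\dagger\Big)^M|0\rangle$$ be the uniform state of $M$ quartets on $N_s$ cells. Let $\lambda_{\max}^{(k)}$ denote the largest eigenvalue of its full $k$-particle density matrix. Then $$\lambda_{\max}^{(4)}=\frac{M(N_s-M+1)}{N_s},\qquad \lambda_{\max}^{(2)}=\frac{M}{N_s}.$$ Moreover, for distinct cells $\bm R\ne\bm R'$, $$\langle\Psi_M|q_{\bm R}^\dagger q_{\bm R'}|\Psi_M\rangle=\frac{M(N_s-M)}{N_s(N_s-1)},$$ and for all $1\le a<b\le4$, $1\le c<d\le4$, $$\langle\Psi_M|P_{\bm R,ab}^\dagger P_{\bm R',cd}|\Psi_M\rangle=0 .$$ Consequently, at fixed quartet filling $\nu_4=M/N_s$ with $0<\nu_4<1$ and $N_s\to\infty$, $\lambda_{\max}^{(4)}/N_s\to\nu_4(1-\nu_4)>0$ while $\lambda_{\max}^{(2)}/N_s\to0$.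
   Context: There are $N_s$ cells labeled $\bm R$; each carries four fermionic modes with creation operators $c_{\bm R,m}^\dagger$, $m=1,\dots,4$ (canonical anticommutation relations), with vacuum $|0\rangle$. Define $q_{\bm R}^\dagger=c_{\bm R,1}^\dagger c_{\bm R,2}^\dagger c_{\bm R,3}^\dagger c_{\bm R,4}^\dagger$, $q_{\bm R}=(q_{\bm R}^\dagger)^\dagger$, and $P_{\bm R,ab}^\dagger=c_{\bm R,a}^\dagger c_{\bm R,b}^\dagger$, $P_{\bm R,ab}=(P_{\bm R,ab}^\dagger)^\dagger$. The full $k$-particle density matrix of a state is the matrix $\langle B_X^\dagger B_Y\rangle$ indexed by $k$-element sets $X,Y$ of distinct single-particle orbitals (an orbital is a pair $(\bm R,m)$), where $B_X^\dagger$ is the product of the creation operators of the orbitals in $X$ in a fixed canonical ordering (normalized antisymmetric occupation basis). *)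

theory Defs
  imports Complex_Main "Jordan_Normal_Form.Char_Poly"
begin

section \<open>Fermionic Fock space on a finite family of cells\<close>

text \<open>
  The cells are labelled by \<open>0, \<dots>, Ns - 1\<close> and the modes of a cell by \<open>1, \<dots>, 4\<close>.  The fixed
  canonical ordering of the orbitals is the lexicographic one.
\<close>

type_synonym orbital = "nat \<times> nat"

definition orbital_less :: "orbital \<Rightarrow> orbital \<Rightarrow> bool" where
  "orbital_less x y \<longleftrightarrow> fst x < fst y \<or> (fst x = fst y \<and> snd x < snd y)"

definition orbital_list :: "nat \<Rightarrow> orbital list" where
  "orbital_list Ns = List.product [0..<Ns] [1..<5]"

definition orbitals :: "nat \<Rightarrow> orbital set" where
  "orbitals Ns = {..<Ns} \<times> {1..4}"

text \<open>
  A state is given by its amplitudes in the occupation number basis: \<open>\<psi> S\<close> is the coefficient of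
  the basis vector in which exactly the orbitals in \<open>S\<close> are occupied.  The Fock space over
  \<open>Ns\<close> cells consists of the states that vanish off \<open>Pow (orbitals Ns)\<close>.
\<close>

type_synonym state = "orbital set \<Rightarrow> complex"

definition fock :: "nat \<Rightarrow> state set" where
  "fock Ns = {\<psi>. \<forall>S. \<not> S \<subseteq> orbitals Ns \<longrightarrow> \<psi> S = 0}"

definition ket :: "orbital set \<Rightarrow> state" where
  "ket S = (\<lambda>T. if T = S then 1 else 0)"

definition vacuum :: state where
  "vacuum = ket {}"

definition inner_prod :: "nat \<Rightarrow> state \<Rightarrow> state \<Rightarrow> complex" where
  "inner_prod Ns \<phi> \<psi> = (\<Sum>S\<in>Pow (orbitals Ns). cnj (\<phi> S) * \<psi> S)"

definition expval :: "nat \<Rightarrow> state \<Rightarrow> (state \<Rightarrow> state) \<Rightarrow> complex" where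
  "expval Ns \<psi> A = inner_prod Ns \<psi> (A \<psi>)"

text \<open>
  The adjoint is the conjugate transpose in the occupation number basis: the matrix element of
  \<open>adj_op Ns A\<close> between \<open>ket S\<close> and \<open>ket T\<close> is \<open>cnj (A (ket S) T)\<close>.
\<close>

definition adj_op :: "nat \<Rightarrow> (state \<Rightarrow> state) \<Rightarrow> (state \<Rightarrow> state)" where
  "adj_op Ns A \<psi> = (\<lambda>S. if S \<subseteq> orbitals Ns
     then (\<Sum>T\<in>Pow (orbitals Ns). cnj (A (ket S) T) * \<psi> T) else 0)"

text \<open>
  Jordan--Wigner sign: \<open>ket {x\<^sub>1, \<dots>, x\<^sub>n}\<close> with \<open>x\<^sub>1, \<dots>, x\<^sub>n\<close> increasing is the product
  of the creation operators of \<open>x\<^sub>1, \<dots>, x\<^sub>n\<close>, in this order from left to right, applied to the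
  vacuum.
\<close>

definition jw_sign :: "orbital \<Rightarrow> orbital set \<Rightarrow> complex" where
  "jw_sign x S = (- 1) ^ card {y \<in> S. orbital_less y x}"

definition cdag :: "orbital \<Rightarrow> state \<Rightarrow> state" where
  "cdag x \<psi> = (\<lambda>S. if x \<in> S then jw_sign x S * \<psi> (S - {x}) else 0)"

definition qdag :: "nat \<Rightarrow> state \<Rightarrow> state" where
  "qdag R = cdag (R, 1) \<circ> cdag (R, 2) \<circ> cdag (R, 3) \<circ> cdag (R, 4)"

definition qann :: "nat \<Rightarrow> nat \<Rightarrow> state \<Rightarrow> state" where
  "qann Ns R = adj_op Ns (qdag R)"

definition Pdag :: "nat \<Rightarrow> nat \<Rightarrow> nat \<Rightarrow> state \<Rightarrow> state" where
  "Pdag R a b = cdag (R, a) \<circ> cdag (R, b)"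

definition Pann :: "nat \<Rightarrow> nat \<Rightarrow> nat \<Rightarrow> nat \<Rightarrow> state \<Rightarrow> state" where
  "Pann Ns R a b = adj_op Ns (Pdag R a b)"

definition qdag_total :: "nat \<Rightarrow> state \<Rightarrow> state" where
  "qdag_total Ns \<psi> = (\<lambda>S. \<Sum>R<Ns. qdag R \<psi> S)"

definition Psi :: "nat \<Rightarrow> nat \<Rightarrow> state" where
  "Psi Ns M = (\<lambda>S. complex_of_real (1 / (fact M * sqrt (real (Ns choose M))))
     * (qdag_total Ns ^^ M) vacuum S)"


section \<open>Reduced density matrices\<close>

text \<open>
  A set of \<open>k\<close> distinct orbitals is represented by the list of its elements in canonical order
  (lemmas \<open>bij_betw_orbital_ksets\<close> and \<open>sorted_orbital_ksets\<close> below).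
\<close>

definition orbital_ksets :: "nat \<Rightarrow> nat \<Rightarrow> orbital list list" where
  "orbital_ksets Ns k = filter (\<lambda>X. length X = k) (subseqs (orbital_list Ns))"

definition Bdag :: "orbital list \<Rightarrow> state \<Rightarrow> state" where
  "Bdag X = foldr (\<lambda>x A. cdag x \<circ> A) X id"

definition density_matrix :: "nat \<Rightarrow> nat \<Rightarrow> state \<Rightarrow> complex mat" where
  "density_matrix Ns k \<psi> =
     (let Xs = orbital_ksets Ns k in
      mat (length Xs) (length Xs)
        (\<lambda>(i, j). expval Ns \<psi> (Bdag (Xs ! i) \<circ> adj_op Ns (Bdag (Xs ! j)))))"

text \<open>
  The density matrix is Hermitian (lemma \<open>density_matrix_hermitian\<close> below), so all its eigenvalues
  are real.
\<close>

definition lambda_max :: "nat \<Rightarrow> nat \<Rightarrow> nat \<Rightarrow> real" where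
  "lambda_max Ns M k =
     Max {x. eigenvalue (density_matrix Ns k (Psi Ns M)) (complex_of_real x)}"


section \<open>Consistency of the definitions\<close>

lemma finite_orbitals [simp]: "finite (orbitals Ns)"
  by (simp add: orbitals_def)

lemma set_orbital_list: "set (orbital_list Ns) = orbitals Ns"
  by (auto simp: orbital_list_def orbitals_def)

lemma orbital_less_linear: "orbital_less x y \<or> x = y \<or> orbital_less y x"
  by (auto simp: orbital_less_def prod_eq_iff)

lemma orbital_less_asym: "orbital_less x y \<Longrightarrow> \<not> orbital_less y x"
  by (auto simp: orbital_less_def)

lemma sorted_orbital_list: "sorted_wrt orbital_less (orbital_list Ns)"
proof -
  have "sorted_wrt orbital_less (List.product xs ys)"
    if "sorted_wrt (<) xs" "sorted_wrt (<) ys" for xs ys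
    using that
    by (induction xs)
       (auto simp: sorted_wrt_append sorted_wrt_map orbital_less_def)
  then show ?thesis
    by (simp add: orbital_list_def)
qed

lemma distinct_orbital_list: "distinct (orbital_list Ns)"
  by (simp add: orbital_list_def distinct_product)

lemma sorted_orbital_ksets:
  assumes "X \<in> set (orbital_ksets Ns k)"
  shows "sorted_wrt orbital_less X"
proof -
  have "sorted_wrt orbital_less ys" if "ys \<in> set (subseqs xs)" "sorted_wrt orbital_less xs"
    for xs ys
  proof -
    have sub: "z \<in> set us" if "zs \<in> set (subseqs us)" "z \<in> set zs" for z :: orbital and zs us
      using that subseqs_powset[of us] by auto
    show ?thesis
      using that
    proof (induction xs arbitrary: ys)
      case (Cons x xs)
      have "\<forall>z\<in>set zs. orbital_less x z" if "zs \<in> set (subseqs xs)" for zs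
        using sub[OF that] Cons.prems(2) by simp
      then show ?case using Cons by (auto simp: Let_def simp del: split_paired_All)
    qed simp
  qed
  then show ?thesis
    using assms sorted_orbital_list by (auto simp: orbital_ksets_def)
qed

lemma distinct_orbital_ksets: "distinct (orbital_ksets Ns k)"
proof -
  have "distinct (map set (subseqs (orbital_list Ns)))"
    by (rule distinct_set_subseqs[OF distinct_orbital_list])
  then have "distinct (subseqs (orbital_list Ns))"
    by (simp add: distinct_map)
  then show ?thesis
    by (simp add: orbital_ksets_def)
qed

lemma bij_betw_orbital_ksets:
  "bij_betw set (set (orbital_ksets Ns k)) {X. X \<subseteq> orbitals Ns \<and> card X = k}"
proof -
  let ?S = "subseqs (orbital_list Ns)"
  have inj: "inj_on set (set ?S)"
    using distinct_set_subseqs[OF distinct_orbital_list, of Ns] by (simp add: distinct_map)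
  have img: "set ` set ?S = Pow (orbitals Ns)"
    using subseqs_powset[of "orbital_list Ns"] by (simp add: set_orbital_list)
  have len: "length X = card (set X)" if "X \<in> set ?S" for X
    using subseqs_distinctD[OF that distinct_orbital_list] by (simp add: distinct_card)
  have "set ` set (orbital_ksets Ns k) = {X. X \<subseteq> orbitals Ns \<and> card X = k}"
  proof (intro equalityI subsetI)
    fix Y assume "Y \<in> set ` set (orbital_ksets Ns k)"
    then show "Y \<in> {X. X \<subseteq> orbitals Ns \<and> card X = k}"
      using img len by (auto simp: orbital_ksets_def)
  next
    fix Y assume Y: "Y \<in> {X. X \<subseteq> orbitals Ns \<and> card X = k}"
    then have "Y \<in> set ` set ?S" using img by simp
    then obtain X where "X \<in> set ?S" "Y = set X" by auto
    then show "Y \<in> set ` set (orbital_ksets Ns k)"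
      using len Y by (auto simp: orbital_ksets_def)
  qed
  moreover have "inj_on set (set (orbital_ksets Ns k))"
    using inj by (rule inj_on_subset) (auto simp: orbital_ksets_def)
  ultimately show ?thesis by (simp add: bij_betw_def)
qed

text \<open>Canonical anticommutation relations.\<close>

lemma jw_sign_sq: "jw_sign x S * jw_sign x S = 1"
  by (simp add: jw_sign_def flip: power_mult_distrib)

lemma jw_sign_insert:
  assumes "finite S" "y \<notin> S"
  shows "jw_sign x (insert y S) = (if orbital_less y x then - jw_sign x S else jw_sign x S)"
proof -
  have "{z \<in> insert y S. orbital_less z x} =
      (if orbital_less y x then insert y {z \<in> S. orbital_less z x} else {z \<in> S. orbital_less z x})"
    by auto
  then show ?thesis using assms by (simp add: jw_sign_def)
qed

lemma jw_sign_remove: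
  assumes "finite S" "y \<in> S"
  shows "jw_sign x (S - {y}) = (if orbital_less y x then - jw_sign x S else jw_sign x S)"
  using jw_sign_insert[of "S - {y}" y x] assms by (auto simp: insert_absorb)

lemma cdag_anticommute:
  assumes "finite S"
  shows "cdag x (cdag y \<psi>) S + cdag y (cdag x \<psi>) S = 0"
proof (cases "x \<in> S \<and> y \<in> S \<and> x \<noteq> y")
  case True
  then have "S - {x} - {y} = S - {y} - {x}" by auto
  then show ?thesis
    using True assms orbital_less_linear[of x y] orbital_less_asym[of x y]
    by (auto simp: cdag_def jw_sign_remove)
next
  case False
  then show ?thesis by (auto simp: cdag_def)
qed

lemma adj_cdag:
  assumes "x \<in> orbitals Ns"
  shows "adj_op Ns (cdag x) \<psi> = (\<lambda>S. if S \<subseteq> orbitals Ns \<and> x \<notin> S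
           then jw_sign x S * \<psi> (insert x S) else 0)"
proof
  fix S
  show "adj_op Ns (cdag x) \<psi> S = (if S \<subseteq> orbitals Ns \<and> x \<notin> S
           then jw_sign x S * \<psi> (insert x S) else 0)"
  proof (cases "S \<subseteq> orbitals Ns")
    case True
    then have fin: "finite S" by (rule finite_subset) simp
    have eq: "cnj (cdag x (ket S) T) * \<psi> T =
        (if T = insert x S then (if x \<notin> S then jw_sign x S * \<psi> (insert x S) else 0) else 0)" for T
    proof (cases "x \<in> T \<and> T - {x} = S")
      case True
      then have T: "T = insert x S" and x: "x \<notin> S" by auto
      have "jw_sign x (insert x S) = jw_sign x S"
        using jw_sign_insert[OF fin x, of x] orbital_less_asym[of x x] by auto
      moreover have "cnj (jw_sign x S) = jw_sign x S" by (simp add: jw_sign_def)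
      ultimately show ?thesis using T x by (simp add: cdag_def ket_def)
    next
      case False
      then have "cdag x (ket S) T = 0" by (auto simp: cdag_def ket_def)
      moreover have "\<not> (T = insert x S \<and> x \<notin> S)" using False by auto
      ultimately show ?thesis by auto
    qed
    have "insert x S \<in> Pow (orbitals Ns)" using True assms by auto
    then show ?thesis using True by (simp add: adj_op_def eq sum.delta)
  qed (simp add: adj_op_def)
qed

lemma cdag_adj_anticommute:
  assumes "x \<in> orbitals Ns" "y \<in> orbitals Ns" "\<psi> \<in> fock Ns"
  shows "adj_op Ns (cdag x) (cdag y \<psi>) S + cdag y (adj_op Ns (cdag x) \<psi>) S
    = (if x = y then \<psi> S else 0)"
proof (cases "S \<subseteq> orbitals Ns")
  case True
  then have fin: "finite S" by (rule finite_subset) simp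
  have sub: "S - {y} \<subseteq> orbitals Ns" using True by auto
  show ?thesis
  proof (cases "x = y")
    case [simp]: True
    have "orbital_less y y = False" using orbital_less_asym by blast
    then show ?thesis
      using sub \<open>S \<subseteq> orbitals Ns\<close> assms jw_sign_sq[of y S] jw_sign_insert[OF fin, of y y]
        jw_sign_remove[OF fin, of y y]
      by (auto simp: adj_cdag cdag_def insert_absorb simp flip: mult.assoc)
  next
    case False
    show ?thesis
    proof (cases "x \<notin> S \<and> y \<in> S")
      case True
      then have "insert x S - {y} = insert x (S - {y})" using False by auto
      then show ?thesis
        using True False sub \<open>S \<subseteq> orbitals Ns\<close> assms fin
          orbital_less_linear[of x y] orbital_less_asym[of x y]
        by (auto simp: adj_cdag cdag_def jw_sign_remove jw_sign_insert)
    next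
      case F2: False
      then show ?thesis using False assms by (auto simp: adj_cdag cdag_def)
    qed
  qed
next
  case False
  then have "\<not> S - {y} \<subseteq> orbitals Ns" using assms by auto
  with False assms show ?thesis by (auto simp: adj_cdag cdag_def fock_def)
qed

text \<open>\<open>adj_op\<close> is the adjoint of linear operators with respect to \<open>inner_prod\<close>.\<close>

definition fock_linear :: "nat \<Rightarrow> (state \<Rightarrow> state) \<Rightarrow> bool" where
  "fock_linear Ns A \<longleftrightarrow> (\<forall>\<psi>\<in>fock Ns. A \<psi> \<in> fock Ns \<and>
     (\<forall>S. A \<psi> S = (\<Sum>T\<in>Pow (orbitals Ns). \<psi> T * A (ket T) S)))"

lemma inner_prod_adj:
  assumes "fock_linear Ns A" "\<psi> \<in> fock Ns"
  shows "inner_prod Ns (adj_op Ns A \<phi>) \<psi> = inner_prod Ns \<phi> (A \<psi>)"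
proof -
  have "inner_prod Ns (adj_op Ns A \<phi>) \<psi> =
      (\<Sum>S\<in>Pow (orbitals Ns). \<Sum>T\<in>Pow (orbitals Ns). A (ket S) T * cnj (\<phi> T) * \<psi> S)"
    by (simp add: inner_prod_def adj_op_def sum_distrib_right cnj_sum)
  also have "\<dots> = (\<Sum>T\<in>Pow (orbitals Ns). \<Sum>S\<in>Pow (orbitals Ns). A (ket S) T * cnj (\<phi> T) * \<psi> S)"
    by (rule sum.swap)
  also have "\<dots> = inner_prod Ns \<phi> (A \<psi>)"
    using assms by (simp add: inner_prod_def fock_linear_def sum_distrib_left mult_ac)
  finally show ?thesis .
qed

lemma adj_op_fock: "adj_op Ns A \<psi> \<in> fock Ns"
  by (simp add: adj_op_def fock_def)

lemma ket_fock: "S \<subseteq> orbitals Ns \<Longrightarrow> ket S \<in> fock Ns"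
  by (auto simp: ket_def fock_def)

lemma fock_expand:
  assumes "\<psi> \<in> fock Ns"
  shows "\<psi> S = (\<Sum>T\<in>Pow (orbitals Ns). \<psi> T * ket T S)"
proof -
  have "(\<Sum>T\<in>Pow (orbitals Ns). \<psi> T * ket T S) =
      (\<Sum>T\<in>Pow (orbitals Ns). if T = S then \<psi> S else 0)"
    by (rule sum.cong) (auto simp: ket_def)
  also have "\<dots> = \<psi> S" using assms by (auto simp: fock_def)
  finally show ?thesis by simp
qed

lemma fock_linear_id: "fock_linear Ns id"
  unfolding fock_linear_def id_apply using fock_expand by blast

lemma fock_linear_cdag_comp:
  assumes "x \<in> orbitals Ns" "fock_linear Ns A"
  shows "fock_linear Ns (cdag x \<circ> A)"
proof -
  have "cdag x \<phi> \<in> fock Ns" if "\<phi> \<in> fock Ns" for \<phi>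
  proof -
    have "\<not> S - {x} \<subseteq> orbitals Ns" if "\<not> S \<subseteq> orbitals Ns" for S
      using that assms(1) by auto
    then show ?thesis using that by (auto simp: fock_def cdag_def)
  qed
  moreover have "cdag x (A \<psi>) S = (\<Sum>T\<in>Pow (orbitals Ns). \<psi> T * cdag x (A (ket T)) S)"
    if "\<psi> \<in> fock Ns" for \<psi> S
  proof (cases "x \<in> S")
    case True
    have "A \<psi> (S - {x}) = (\<Sum>T\<in>Pow (orbitals Ns). \<psi> T * A (ket T) (S - {x}))"
      using that assms(2) by (auto simp: fock_linear_def)
    then show ?thesis using True by (simp add: cdag_def sum_distrib_left mult_ac)
  qed (simp add: cdag_def)
  ultimately show ?thesis using assms(2) by (auto simp: fock_linear_def)
qed

lemma fock_linear_Bdag: "set X \<subseteq> orbitals Ns \<Longrightarrow> fock_linear Ns (Bdag X)"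
proof (induction X)
  case Nil
  then show ?case using fock_linear_id[of Ns] by (simp add: Bdag_def id_def)
next
  case (Cons x X)
  then have "fock_linear Ns (cdag x \<circ> Bdag X)" by (intro fock_linear_cdag_comp) auto
  then show ?case by (simp add: Bdag_def comp_def)
qed

lemma density_matrix_hermitian:
  assumes "i < length (orbital_ksets Ns k)" "j < length (orbital_ksets Ns k)"
  shows "density_matrix Ns k \<psi> $$ (j, i) = cnj (density_matrix Ns k \<psi> $$ (i, j))"
proof -
  have lin: "fock_linear Ns (Bdag (orbital_ksets Ns k ! i))" if "i < length (orbital_ksets Ns k)" for i
    using bij_betw_imp_surj_on[OF bij_betw_orbital_ksets, of Ns k] nth_mem[OF that]
    by (intro fock_linear_Bdag) blast
  have el: "expval Ns \<psi> (Bdag (orbital_ksets Ns k ! i) \<circ> adj_op Ns (Bdag (orbital_ksets Ns k ! j)))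
     = inner_prod Ns (adj_op Ns (Bdag (orbital_ksets Ns k ! i)) \<psi>)
         (adj_op Ns (Bdag (orbital_ksets Ns k ! j)) \<psi>)" if "i < length (orbital_ksets Ns k)" for i j
    using inner_prod_adj[OF lin[OF that] adj_op_fock] by (simp add: expval_def)
  show ?thesis
    using assms by (simp add: density_matrix_def Let_def el[OF assms(1)] el[OF assms(2)])
      (simp add: inner_prod_def cnj_sum mult.commute)
qed

end

theory Submission
  imports Defs
begin

text \<open>
  The state \<open>Psi Ns M\<close> is the uniform superposition of the occupation sets \<open>full A\<close> with
  \<open>card A = M\<close>.  If \<open>k \<le> 4\<close> and removing \<open>Y\<close> from one such set and adding \<open>X\<close> gives another one,
  then either \<open>X = Y\<close>, or \<open>X\<close> and \<open>Y\<close> are two whole cells.  So the \<open>2\<close>-particle density matrix is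
  diagonal, and the \<open>4\<close>-particle one is diagonal except for the block of the cells, which has
  constant diagonal \<open>M / Ns\<close> and constant off-diagonal entries.  All entries are nonnegative, the
  diagonal ones are at most \<open>M / Ns\<close>, and so the largest row sum bounds the eigenvalues; it is
  attained by the uniform vector on the cells.
\<close>

section \<open>Strings of creation operators\<close>

text \<open>The sign is read off at the target set \<open>S\<close>: the leftmost operator acts last
  and so sees all of \<open>S\<close>, and each further one sees \<open>S\<close> without the
  orbitals to its left.\<close>

fun bdag_sign :: "orbital list \<Rightarrow> orbital set \<Rightarrow> complex" where
  "bdag_sign [] S = 1"
| "bdag_sign (x # X) S = jw_sign x S * bdag_sign X (S - {x})"

lemma Bdag_Cons: "Bdag (x # X) \<phi> = cdag x (Bdag X \<phi>)"
  by (simp add: Bdag_def)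

lemma Bdag_apply:
  "distinct X \<Longrightarrow> Bdag X \<phi> S = (if set X \<subseteq> S then bdag_sign X S * \<phi> (S - set X) else 0)"
proof (induction X arbitrary: S)
  case Nil
  then show ?case by (simp add: Bdag_def)
next
  case (Cons x X)
  then have "set X \<subseteq> S - {x} \<longleftrightarrow> set X \<subseteq> S" by auto
  moreover have "S - {x} - set X = S - set (x # X)" by auto
  ultimately show ?case
    using Cons by (simp add: Bdag_Cons cdag_def del: Diff_insert)
qed

lemma cnj_bdag_sign [simp]: "cnj (bdag_sign X S) = bdag_sign X S"
  by (induction X arbitrary: S) (auto simp: jw_sign_def)

lemma bdag_sign_sq [simp]: "bdag_sign X S * bdag_sign X S = 1"
proof (induction X arbitrary: S)
  case (Cons x X)
  have "bdag_sign (x # X) S * bdag_sign (x # X) S =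
      (jw_sign x S * jw_sign x S) * (bdag_sign X (S - {x}) * bdag_sign X (S - {x}))"
    by (simp add: mult_ac)
  then show ?case by (simp add: Cons jw_sign_sq)
qed simp

text \<open>At most one \<open>T\<close> contributes, namely \<open>S\<close> together with
  \<open>set X\<close>. Keeping the sum over \<open>T\<close> makes the correlator below a double
  sum that treats the two states alike.\<close>

lemma adj_Bdag_apply:
  assumes "distinct X" "S \<subseteq> orbitals Ns"
  shows "adj_op Ns (Bdag X) \<psi> S =
    (\<Sum>T\<in>Pow (orbitals Ns). if set X \<subseteq> T \<and> T - set X = S then bdag_sign X T * \<psi> T else 0)"
  unfolding adj_op_def using assms by (auto simp: Bdag_apply ket_def intro!: sum.cong)

lemma expval_Bdag_adj_Bdag:
  assumes "distinct X" "distinct Y"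
  shows "expval Ns \<psi> (Bdag X \<circ> adj_op Ns (Bdag Y)) =
    (\<Sum>S\<in>Pow (orbitals Ns). \<Sum>T\<in>Pow (orbitals Ns).
       if set X \<subseteq> S \<and> set Y \<subseteq> T \<and> S - set X = T - set Y
       then bdag_sign X S * bdag_sign Y T * cnj (\<psi> S) * \<psi> T else 0)"
proof -
  have "cnj (\<psi> S) * Bdag X (adj_op Ns (Bdag Y) \<psi>) S = (\<Sum>T\<in>Pow (orbitals Ns).
       if set X \<subseteq> S \<and> set Y \<subseteq> T \<and> S - set X = T - set Y
       then bdag_sign X S * bdag_sign Y T * cnj (\<psi> S) * \<psi> T else 0)"
    if "S \<in> Pow (orbitals Ns)" for S
  proof -
    have "S - set X \<subseteq> orbitals Ns" using that by auto
    then show ?thesis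
      using assms by (auto simp: Bdag_apply adj_Bdag_apply sum_distrib_left intro!: sum.cong)
  qed
  then show ?thesis by (simp add: expval_def inner_prod_def)
qed

section \<open>Completely filled cells\<close>

definition full :: "nat set \<Rightarrow> orbital set" where
  "full A = A \<times> {1..4}"

text \<open>Listed in canonical order, so that \<open>qdag R\<close> is literally the operator
  string of this list and the list can occur as an index of the density matrix.\<close>

definition cell_list :: "nat \<Rightarrow> orbital list" where
  "cell_list R = [(R, 1), (R, 2), (R, 3), (R, 4)]"

lemma set_cell_list [simp]: "set (cell_list R) = full {R}"
proof -
  have "{1..4} = {1, 2, 3, 4 :: nat}" by auto
  then show ?thesis by (simp add: cell_list_def full_def)
qed

lemma distinct_cell_list [simp]: "distinct (cell_list R)"
  by (simp add: cell_list_def)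

lemma inj_cell_list: "inj_on cell_list A"
  by (auto simp: inj_on_def cell_list_def)

lemma full_subset_iff [simp]: "full A \<subseteq> full B \<longleftrightarrow> A \<subseteq> B"
  unfolding full_def by (rule Times_subset_cancel2[of 1]) simp

lemma full_eq_iff [simp]: "full A = full B \<longleftrightarrow> A = B"
  by (metis full_subset_iff subset_antisym order_refl)

lemma full_Diff: "full A - full B = full (A - B)"
  by (auto simp: full_def)

lemma card_full: "card (full A) = 4 * card A"
  by (simp add: full_def card_cartesian_product)

lemma full_subset_orbitals [simp]: "full A \<subseteq> orbitals Ns \<longleftrightarrow> A \<subseteq> {..<Ns}"
  using full_subset_iff[of A "{..<Ns}"] by (simp add: full_def orbitals_def)

text \<open>Each of the four creation operators of a cell has to pass the same orbitals, namely those in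
  the preceding cells, so the four Jordan--Wigner signs cancel.\<close>

lemma bdag_sign_cell_list: "bdag_sign (cell_list R) S = 1"
proof -
  let ?Z = "{y \<in> S. orbital_less y (R, 1)}"
  have
    "{y \<in> S - {(R, 1)}. orbital_less y (R, 2)} = ?Z"
    "{y \<in> S - {(R, 1)} - {(R, 2)}. orbital_less y (R, 3)} = ?Z"
    "{y \<in> S - {(R, 1)} - {(R, 2)} - {(R, 3)}. orbital_less y (R, 4)} = ?Z"
    by (auto simp: orbital_less_def)
  then have "bdag_sign (cell_list R) S = ((- 1) ^ card ?Z) ^ 4"
    unfolding cell_list_def by (simp add: jw_sign_def power4_eq_xxxx mult.assoc)
  then show ?thesis by (simp flip: power_mult)
qed

section \<open>Amplitudes of the quartet state\<close>

lemma qdag_eq_Bdag: "qdag R = Bdag (cell_list R)"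
  by (simp add: qdag_def Bdag_def cell_list_def comp_assoc)

lemma Pdag_eq_Bdag: "Pdag R a b = Bdag [(R, a), (R, b)]"
  by (simp add: Pdag_def Bdag_def)

lemma qdag_apply: "qdag R \<phi> S = (if full {R} \<subseteq> S then \<phi> (S - full {R}) else 0)"
  by (simp add: qdag_eq_Bdag Bdag_apply bdag_sign_cell_list)

text \<open>Quartets are created without signs, so the amplitude of \<open>full A\<close> counts the
  orders in which the \<open>m\<close> cells of \<open>A\<close> can be filled. In the induction the
  cell filled last may be any of the \<open>m + 1\<close> cells of \<open>A\<close>.\<close>

lemma qdag_total_power_vacuum:
  "(qdag_total Ns ^^ m) vacuum S =
     (if \<exists>A\<subseteq>{..<Ns}. card A = m \<and> S = full A then fact m else 0)"
proof (induction m arbitrary: S)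
  case 0
  \<comment> \<open>Infinite sets also have \<open>card\<close> 0; the bound \<open>{..<Ns}\<close>
    leaves only the empty set.\<close>
  have "(\<exists>A\<subseteq>{..<Ns}. card A = 0 \<and> S = full A) \<longleftrightarrow> S = {}"
    by (auto simp: full_def card_eq_0_iff dest: finite_subset)
  then show ?case by (simp add: vacuum_def ket_def)
next
  case (Suc m)
  let ?Q = "\<lambda>m S. \<exists>A\<subseteq>{..<Ns}. card A = m \<and> S = full A"
  have step: "(qdag_total Ns ^^ Suc m) vacuum S =
      (\<Sum>R<Ns. if full {R} \<subseteq> S \<and> ?Q m (S - full {R}) then fact m else 0)"
    by (auto simp: qdag_total_def qdag_apply Suc.IH intro!: sum.cong)
  show ?case
  proof (cases "?Q (Suc m) S")
    case True
    then obtain A where A: "A \<subseteq> {..<Ns}" "card A = Suc m" "S = full A" by blast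
    then have fin: "finite A" by (meson finite_lessThan finite_subset)
    have "full {R} \<subseteq> S \<and> ?Q m (S - full {R}) \<longleftrightarrow> R \<in> A" for R
    proof
      assume "R \<in> A"
      then have "A - {R} \<subseteq> {..<Ns}" "card (A - {R}) = m" "S - full {R} = full (A - {R})"
        using A fin by (auto simp: full_Diff)
      then show "full {R} \<subseteq> S \<and> ?Q m (S - full {R})" using A \<open>R \<in> A\<close> by auto
    qed (use A in auto)
    then have "(qdag_total Ns ^^ Suc m) vacuum S = (\<Sum>R<Ns. if R \<in> A then fact m else 0)"
      by (simp only: step)
    also have "\<dots> = (\<Sum>R\<in>A. fact m)"
      using A by (simp add: sum.If_cases Int_absorb1)
    finally show ?thesis using True A by simp
  next
    case False
    have "\<not> (full {R} \<subseteq> S \<and> ?Q m (S - full {R}))" if "R < Ns" for R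
    proof
      assume "full {R} \<subseteq> S \<and> ?Q m (S - full {R})"
      then obtain A where A: "A \<subseteq> {..<Ns}" "card A = m" "S - full {R} = full A"
        and R: "full {R} \<subseteq> S" by blast
      from R A have S: "S = full (insert R A)" by (auto simp: full_def)
      \<comment> \<open>Needed so that \<open>insert R A\<close> has exactly \<open>Suc m\<close>
        elements; the orbital \<open>(R, 1)\<close> was removed and so cannot lie in
        \<open>full A\<close>.\<close>
      have "R \<notin> A"
      proof
        assume "R \<in> A"
        then have "(R, 1) \<in> full A" by (simp add: full_def)
        then have "(R, 1) \<notin> full {R}" using A(3) by blast
        then show False by (simp add: full_def)
      qed
      moreover have "finite A" using A by (meson finite_lessThan finite_subset)
      ultimately have "?Q (Suc m) S" using A S that by (intro exI[of _ "insert R A"]) auto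
      with False show False by blast
    qed
    then have "(qdag_total Ns ^^ Suc m) vacuum S = 0"
      unfolding step by (intro sum.neutral) auto
    then show ?thesis unfolding if_not_P[OF False] .
  qed
qed

definition cell_subsets :: "nat \<Rightarrow> nat \<Rightarrow> nat set set" where
  "cell_subsets Ns M = {A. A \<subseteq> {..<Ns} \<and> card A = M}"

lemma finite_cell_subsets [simp]: "finite (cell_subsets Ns M)"
  by (auto simp: cell_subsets_def intro: finite_subset[of _ "Pow {..<Ns}"])

text \<open>The prefactor \<open>1 / fact M\<close> cancels the number of filling orders, leaving
  equal amplitudes on the cell sets of size \<open>M\<close>.\<close>

lemma Psi_apply:
  "Psi Ns M S = (if S \<in> full ` cell_subsets Ns M
     then complex_of_real (1 / sqrt (real (Ns choose M))) else 0)"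
proof -
  have *: "(\<exists>A\<subseteq>{..<Ns}. card A = M \<and> S = full A) \<longleftrightarrow> S \<in> full ` cell_subsets Ns M"
    by (auto simp: cell_subsets_def)
  show ?thesis unfolding Psi_def qdag_total_power_vacuum * by simp
qed

section \<open>Correlators of the quartet state\<close>

text \<open>Only occupation sets \<open>full A\<close> carry amplitude, so both sums are pulled back
  along the injection \<open>full\<close>; the two equal amplitudes multiply to one over the
  binomial coefficient.\<close>

lemma expval_Psi:
  assumes "distinct X" "distinct Y"
  shows "expval Ns (Psi Ns M) (Bdag X \<circ> adj_op Ns (Bdag Y)) =
    (\<Sum>A\<in>cell_subsets Ns M. \<Sum>B\<in>cell_subsets Ns M.
       if set X \<subseteq> full A \<and> set Y \<subseteq> full B \<and> full A - set X = full B - set Y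
       then bdag_sign X (full A) * bdag_sign Y (full B) else 0) / of_nat (Ns choose M)"
    (is "_ = ?R")
proof -
  let ?K = "cell_subsets Ns M" and ?c = "complex_of_real (1 / sqrt (real (Ns choose M)))"
  let ?f = "\<lambda>S T. if set X \<subseteq> S \<and> set Y \<subseteq> T \<and> S - set X = T - set Y
       then bdag_sign X S * bdag_sign Y T * cnj (Psi Ns M S) * Psi Ns M T else 0"
  have sub: "full ` ?K \<subseteq> Pow (orbitals Ns)"
    unfolding cell_subsets_def image_subset_iff Pow_iff by simp
  have inj: "inj_on full ?K" by (simp add: inj_on_def)
  have c: "cnj ?c * ?c = 1 / of_nat (Ns choose M)"
    by (simp flip: of_real_mult)
  have "expval Ns (Psi Ns M) (Bdag X \<circ> adj_op Ns (Bdag Y)) =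
      (\<Sum>S\<in>Pow (orbitals Ns). \<Sum>T\<in>Pow (orbitals Ns). ?f S T)"
    by (rule expval_Bdag_adj_Bdag[OF assms])
  also have "\<dots> = (\<Sum>S\<in>full ` ?K. \<Sum>T\<in>Pow (orbitals Ns). ?f S T)"
    by (rule sum.mono_neutral_right[OF _ sub]) (auto simp: Psi_apply intro!: sum.neutral)
  also have "\<dots> = (\<Sum>S\<in>full ` ?K. \<Sum>T\<in>full ` ?K. ?f S T)"
    by (rule sum.cong[OF refl], rule sum.mono_neutral_right[OF _ sub]) (auto simp: Psi_apply)
  also have "\<dots> = (\<Sum>A\<in>?K. \<Sum>B\<in>?K. ?f (full A) (full B))"
    by (simp add: sum.reindex[OF inj])
  also have "\<dots> = (\<Sum>A\<in>?K. \<Sum>B\<in>?K. (if set X \<subseteq> full A \<and> set Y \<subseteq> full B \<and> full A - set X = full B - set Y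
       then bdag_sign X (full A) * bdag_sign Y (full B) else 0) * (cnj ?c * ?c))"
    by (intro sum.cong refl) (auto simp: Psi_apply)
  also have "\<dots> = ?R"
    unfolding c by (simp add: sum_divide_distrib)
  finally show ?thesis .
qed

text \<open>Two different sets of the same size each have an element outside the other. A cell in
  \<open>A - B\<close> is absent from \<open>full B\<close>, so \<open>V\<close> has to remove all
  four of its orbitals, and having at most four elements \<open>V\<close> is that cell. The same
  argument applies to \<open>W\<close>.\<close>

lemma full_Diff_eq_full_Diff:
  assumes "A \<in> cell_subsets Ns M" "B \<in> cell_subsets Ns M" "A \<noteq> B"
    and "V \<subseteq> full A" "W \<subseteq> full B" "full A - V = full B - W"
    and "finite V" "finite W" "card V \<le> 4" "card W \<le> 4"
  obtains R R' where "R \<in> A - B" "R' \<in> B - A" "V = full {R}" "W = full {R'}"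
proof -
  have fin: "finite A" "finite B" and card: "card A = card B"
    using assms(1,2) by (auto simp: cell_subsets_def intro: finite_subset)
  have *: "V = full {R}" if "R \<in> A - B" "full A - V = full B - W" "finite V" "card V \<le> 4"
    for R A B V W
  proof -
    have "full {R} \<subseteq> V" using that by (force simp: full_def)
    then show ?thesis
      using that card_seteq[of V "full {R}"] by (simp add: card_full)
  qed
  have "\<not> A \<subseteq> B" "\<not> B \<subseteq> A"
    using fin card assms(3) card_subset_eq by metis+
  then obtain R R' where "R \<in> A - B" "R' \<in> B - A" by blast
  with * assms show ?thesis by (metis that)
qed

text \<open>A contributing pair with \<open>A = B\<close> would force \<open>set X = set Y\<close>,
  and one with \<open>A\<close> different from \<open>B\<close> would force two whole cells; both
  are excluded.\<close>

lemma expval_Psi_eq_0: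
  assumes "distinct X" "distinct Y" "length X \<le> 4" "length Y \<le> 4" "set X \<noteq> set Y"
    and "\<And>R R'. R < Ns \<Longrightarrow> R' < Ns \<Longrightarrow> \<not> (set X = full {R} \<and> set Y = full {R'})"
  shows "expval Ns (Psi Ns M) (Bdag X \<circ> adj_op Ns (Bdag Y)) = 0"
proof -
  have "\<not> (set X \<subseteq> full A \<and> set Y \<subseteq> full B \<and> full A - set X = full B - set Y)"
    if AB: "A \<in> cell_subsets Ns M" "B \<in> cell_subsets Ns M" for A B
  proof
    assume *: "set X \<subseteq> full A \<and> set Y \<subseteq> full B \<and> full A - set X = full B - set Y"
    then have "A \<noteq> B" using assms(5) by blast
    then obtain R R' where "R \<in> A - B" "R' \<in> B - A" "set X = full {R}" "set Y = full {R'}"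
      using full_Diff_eq_full_Diff[OF AB \<open>A \<noteq> B\<close>, where V = "set X" and W = "set Y"] * assms(1-4)
      by (metis List.finite_set distinct_card)
    moreover have "A \<subseteq> {..<Ns}" "B \<subseteq> {..<Ns}" using AB by (auto simp: cell_subsets_def)
    ultimately show False using assms(6) by blast
  qed
  then show ?thesis
    using assms(1,2) by (auto simp: expval_Psi intro!: sum.neutral)
qed

text \<open>Equal removed sets force \<open>A = B\<close>, and the sign then occurs squared. What
  remains is the fraction of cell sets that contain every cell touched by \<open>X\<close>.\<close>

lemma expval_Psi_diagonal:
  assumes "distinct X" "set X \<subseteq> orbitals Ns"
  shows "expval Ns (Psi Ns M) (Bdag X \<circ> adj_op Ns (Bdag X)) =
    of_nat (card {A \<in> cell_subsets Ns M. fst ` set X \<subseteq> A}) / of_nat (Ns choose M)"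
proof -
  have iff: "set X \<subseteq> full A \<longleftrightarrow> fst ` set X \<subseteq> A" for A
    using assms(2) by (force simp: full_def orbitals_def)
  have eq: "set X \<subseteq> full A \<and> set X \<subseteq> full B \<and> full A - set X = full B - set X \<longleftrightarrow>
      B = A \<and> fst ` set X \<subseteq> A" for A B
    using full_eq_iff[of A B] iff[of A] by blast
  have "(\<Sum>B\<in>cell_subsets Ns M.
       if set X \<subseteq> full A \<and> set X \<subseteq> full B \<and> full A - set X = full B - set X
       then bdag_sign X (full A) * bdag_sign X (full B) else 0) =
      (if fst ` set X \<subseteq> A then 1 else 0)" if "A \<in> cell_subsets Ns M" for A
  proof -
    have "(\<Sum>B\<in>cell_subsets Ns M.
       if set X \<subseteq> full A \<and> set X \<subseteq> full B \<and> full A - set X = full B - set X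
       then bdag_sign X (full A) * bdag_sign X (full B) else 0) =
      (\<Sum>B\<in>cell_subsets Ns M. if B = A then if fst ` set X \<subseteq> A then 1 else 0 else 0)"
      unfolding eq by (intro sum.cong refl) auto
    then show ?thesis using that by simp
  qed
  then show ?thesis
    using assms(1) by (simp add: expval_Psi sum.If_cases Int_def)
qed

text \<open>Deleting \<open>R\<close> matches the sets counted with the subsets of size
  \<open>M - 1\<close> of the other cells, and absorption turns the quotient of binomials into the
  filling. The case \<open>M = 0\<close> stands apart because it has no predecessor.\<close>

lemma card_cell_subsets_containing:
  assumes "R < Ns" "M \<le> Ns"
  shows "real (card {A \<in> cell_subsets Ns M. R \<in> A}) / real (Ns choose M) = real M / real Ns"
proof (cases M)
  case 0
  have "{A \<in> cell_subsets Ns 0. R \<in> A} = {}"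
    by (auto simp: cell_subsets_def card_eq_0_iff dest: finite_subset)
  with 0 show ?thesis by simp
next
  case (Suc m)
  let ?D = "{D. D \<subseteq> {..<Ns} - {R} \<and> card D = m}"
  have fin: "finite D" if "D \<in> ?D" for D
    using that by (auto intro: finite_subset)
  have "{A \<in> cell_subsets Ns M. R \<in> A} = insert R ` ?D"
  proof (intro equalityI subsetI)
    fix A assume A: "A \<in> {A \<in> cell_subsets Ns M. R \<in> A}"
    then have "A - {R} \<in> ?D" "A = insert R (A - {R})"
      using Suc by (auto simp: cell_subsets_def card_Diff_singleton)
    then show "A \<in> insert R ` ?D" by blast
  next
    fix A assume "A \<in> insert R ` ?D"
    then obtain D where "D \<in> ?D" "A = insert R D" by blast
    then show "A \<in> {A \<in> cell_subsets Ns M. R \<in> A}"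
      using fin[of D] Suc assms(1) by (auto simp: cell_subsets_def card_insert_if)
  qed
  moreover have "inj_on (insert R) ?D"
  proof (rule inj_onI)
    fix D E assume "D \<in> ?D" "E \<in> ?D" and eq: "insert R D = insert R E"
    then have "R \<notin> D" "R \<notin> E" by auto
    with eq show "D = E" by (metis insert_ident)
  qed
  ultimately have "card {A \<in> cell_subsets Ns M. R \<in> A} = (Ns - 1) choose m"
    using assms by (simp add: card_image n_subsets)
  moreover have "real (Suc m) * real (Ns choose Suc m) = real Ns * real ((Ns - 1) choose m)"
    using binomial_absorption[of m Ns] by (metis of_nat_mult)
  ultimately show ?thesis
    using Suc assms by (simp add: field_simps)
qed

lemma sum_sum_indicator:
  assumes "finite K" "finite L"
  shows "(\<Sum>a\<in>K. \<Sum>b\<in>L. if Q a b then 1 else 0) =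
    (of_nat (card {(a, b) \<in> K \<times> L. Q a b}) :: 'a :: semiring_1)"
proof -
  have "(\<Sum>(a, b)\<in>K \<times> L. if Q a b then 1 else 0) =
      (\<Sum>p\<in>{(a, b) \<in> K \<times> L. Q a b}. 1 :: 'a)"
    using assms by (intro sum.mono_neutral_cong_right) (auto split: if_splits)
  then show ?thesis by (simp add: sum.cartesian_product)
qed

text \<open>A contributing pair is determined by its common rest
  \<open>D = A - {R} = B - {R'}\<close>, a set of \<open>M - 1\<close> cells avoiding both
  \<open>R\<close> and \<open>R'\<close>. Each pair contributes 1, so the correlator is a quotient
  of binomials.\<close>

lemma expval_Psi_cells:
  assumes "R < Ns" "R' < Ns" "R \<noteq> R'" "M \<le> Ns"
  shows "expval Ns (Psi Ns M) (Bdag (cell_list R) \<circ> adj_op Ns (Bdag (cell_list R'))) =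
    complex_of_real (real M * (real Ns - real M) / (real Ns * (real Ns - 1)))"
proof -
  let ?K = "cell_subsets Ns M"
  let ?P = "{(A, B) \<in> ?K \<times> ?K. R \<in> A \<and> R' \<in> B \<and> A - {R} = B - {R'}}"
  have "expval Ns (Psi Ns M) (Bdag (cell_list R) \<circ> adj_op Ns (Bdag (cell_list R'))) =
    (\<Sum>A\<in>?K. \<Sum>B\<in>?K. if R \<in> A \<and> R' \<in> B \<and> A - {R} = B - {R'} then 1 else 0)
      / of_nat (Ns choose M)"
    by (simp add: expval_Psi bdag_sign_cell_list full_Diff cong: if_cong)
  also have "(\<Sum>A\<in>?K. \<Sum>B\<in>?K. if R \<in> A \<and> R' \<in> B \<and> A - {R} = B - {R'} then 1 else 0)
      = complex_of_nat (card ?P)"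
    by (rule sum_sum_indicator) simp_all
  also have "complex_of_nat (card ?P) / of_nat (Ns choose M) =
      complex_of_real (real (card ?P) / real (Ns choose M))" by simp
  also have "real (card ?P) / real (Ns choose M) =
      real M * (real Ns - real M) / (real Ns * (real Ns - 1))"
  proof (cases M)
    case 0
    have "?P = {}" using 0
      by (auto simp: cell_subsets_def card_eq_0_iff dest: finite_subset)
    then have "card ?P = 0" by (simp only: card.empty)
    with 0 show ?thesis by simp
  next
    case (Suc m)
    let ?D = "{D. D \<subseteq> {..<Ns} - {R, R'} \<and> card D = m}"
    let ?f = "\<lambda>D. (insert R D, insert R' D)"
    have fin: "finite D" if "D \<in> ?D" for D
      using that by (auto intro: finite_subset)
    have "?P = ?f ` ?D"
    proof (intro equalityI subsetI)
      fix p assume "p \<in> ?P"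
      then obtain A B where p: "p = (A, B)" and AB: "A \<in> ?K" "B \<in> ?K" "R \<in> A" "R' \<in> B"
        "A - {R} = B - {R'}" by blast
      then have "A - {R} \<in> ?D" "A = insert R (A - {R})" "B = insert R' (A - {R})"
        using Suc by (auto simp: cell_subsets_def card_Diff_singleton)
      then show "p \<in> ?f ` ?D" using p by blast
    next
      fix p assume "p \<in> ?f ` ?D"
      then obtain D where D: "D \<in> ?D" "p = ?f D" by blast
      then have "R \<notin> D" "R' \<notin> D" by auto
      then show "p \<in> ?P"
        using D fin[OF D(1)] Suc assms by (auto simp: cell_subsets_def)
    qed
    moreover have "inj_on ?f ?D"
    proof (rule inj_onI)
      fix D E assume "D \<in> ?D" "E \<in> ?D" and eq: "?f D = ?f E"
      then have "R \<notin> D" "R \<notin> E" by auto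
      with eq show "D = E" by (metis Pair_inject insert_ident)
    qed
    moreover have "card ({..<Ns} - {R, R'}) = Ns - 2"
      using assms by (simp add: card_Diff_subset)
    ultimately have card: "card ?P = (Ns - 1 - 1) choose m"
      by (simp add: card_image n_subsets numeral_2_eq_2)
    \<comment> \<open>Two absorption identities lead from \<open>Ns choose M\<close> through
      \<open>(Ns - 1) choose m\<close> to the count \<open>(Ns - 1 - 1) choose m\<close>: the first
      lowers both arguments, the second only the upper one.\<close>
    have "real (Suc m) * real (Ns choose Suc m) = real Ns * real ((Ns - 1) choose m)"
      using binomial_absorption[of m Ns] by (metis of_nat_mult)
    moreover have "(real Ns - real M) * real ((Ns - 1) choose m) =
        (real Ns - 1) * real ((Ns - 1 - 1) choose m)"
    proof -
      have "real (Ns - 1 - m) * real ((Ns - 1) choose m) =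
          real (Ns - 1) * real ((Ns - 1 - 1) choose m)"
        using binomial_absorb_comp[of "Ns - 1" m] by (metis of_nat_mult)
      then show ?thesis using Suc assms by (simp add: of_nat_diff algebra_simps)
    qed
    moreover have "real Ns * (real Ns - 1) \<noteq> 0" using assms by auto
    moreover have "real (Ns choose M) \<noteq> 0" using assms by simp
    \<comment> \<open>Elimination of the intermediate binomial \<open>b\<close> over arbitrary
      reals; \<open>c\<close> and \<open>p\<close> stand for \<open>Ns choose M\<close> and the
      count, \<open>x\<close> and \<open>y\<close> for \<open>M\<close> and \<open>Ns\<close>. The
      denominators are nonzero because two distinct cells give \<open>Ns\<close> at least 2.\<close>
    moreover have "p / c = x * (y - x) / (y * (y - 1))"
      if "x * c = y * b" "(y - x) * b = (y - 1) * p" "y * (y - 1) \<noteq> 0" "c \<noteq> 0"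
      for p b c x y :: real
    proof -
      have "x * (y - x) * c = (y - x) * (x * c)" by simp
      also have "\<dots> = y * ((y - x) * b)" by (simp add: that(1))
      also have "\<dots> = p * (y * (y - 1))" by (simp add: that(2))
      finally show ?thesis using that(3,4) by (metis frac_eq_eq)
    qed
    ultimately show ?thesis unfolding card unfolding Suc by blast
  qed
  finally show ?thesis .
qed

section \<open>Largest eigenvalues\<close>

lemma sorted_wrt_orbital_less_set_unique:
  assumes "sorted_wrt orbital_less X" "sorted_wrt orbital_less Y" "set X = set Y"
  shows "X = Y"
  using assms
proof (induction X arbitrary: Y)
  case (Cons x X)
  then obtain y Z where Y: "Y = y # Z" by (cases Y) auto
  have "x = y"
  proof (rule ccontr)
    assume "x \<noteq> y"
    then have "x \<in> set Z" "y \<in> set X" using Cons.prems(3) Y by auto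
    then have "orbital_less y x" "orbital_less x y" using Cons.prems Y by auto
    then show False using orbital_less_asym by blast
  qed
  have "x \<notin> set X" "x \<notin> set Z"
    using Cons.prems(1,2) Y \<open>x = y\<close> orbital_less_asym[of x x] by auto
  then have "set X = set Z" using Cons.prems(3) Y \<open>x = y\<close> by auto
  then show ?case using Cons Y \<open>x = y\<close> by simp
qed simp

lemma orbital_ksetsD:
  assumes "X \<in> set (orbital_ksets Ns k)"
  shows "distinct X" "length X = k" "set X \<subseteq> orbitals Ns"
proof -
  have X: "X \<in> set (subseqs (orbital_list Ns))" and "length X = k"
    using assms by (auto simp: orbital_ksets_def)
  then show "distinct X" "length X = k"
    using subseqs_distinctD distinct_orbital_list by blast+
  show "set X \<subseteq> orbitals Ns"
    using bij_betwE[OF bij_betw_orbital_ksets] assms by blast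
qed

lemma orbital_ksets_set_eqD:
  assumes "X \<in> set (orbital_ksets Ns k)" "Y \<in> set (orbital_ksets Ns k)" "set X = set Y"
  shows "X = Y"
  by (rule inj_onD[OF bij_betw_imp_inj_on[OF bij_betw_orbital_ksets] assms(3,1,2)])

text \<open>Links the indices of the density matrix to \<open>cell_list\<close>, so that the
  correlators computed for cells are actual matrix entries; both lists are sorted and have the same
  elements.\<close>

lemma orbital_ksets_eq_cell_list:
  assumes "X \<in> set (orbital_ksets Ns k)" "set X = full {R}"
  shows "X = cell_list R"
proof (rule sorted_wrt_orbital_less_set_unique)
  show "sorted_wrt orbital_less X" by (rule sorted_orbital_ksets[OF assms(1)])
  show "sorted_wrt orbital_less (cell_list R)" by (simp add: cell_list_def orbital_less_def)
qed (use assms in simp)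

lemma cell_list_in_orbital_ksets:
  assumes "R < Ns"
  shows "cell_list R \<in> set (orbital_ksets Ns 4)"
proof -
  have "full {R} \<in> {X. X \<subseteq> orbitals Ns \<and> card X = 4}"
    using assms by (simp add: card_full)
  then have "full {R} \<in> set ` set (orbital_ksets Ns 4)"
    unfolding bij_betw_imp_surj_on[OF bij_betw_orbital_ksets] .
  then obtain X where "X \<in> set (orbital_ksets Ns 4)" "set X = full {R}" by force
  with orbital_ksets_eq_cell_list[OF this] show ?thesis by simp
qed

section \<open>Largest eigenvalue from a row-sum bound and an eigenvector\<close>

lemma cmod_eigenvalue_le_row_sum:
  fixes A :: "complex mat"
  assumes A: "A \<in> carrier_mat n n"
    and row: "\<And>i. i < n \<Longrightarrow> (\<Sum>j<n. cmod (A $$ (i, j))) \<le> l"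
    and "eigenvalue A k"
  shows "cmod k \<le> l"
proof -
  obtain v where v: "v \<in> carrier_vec n" "v \<noteq> 0\<^sub>v n" "A *\<^sub>v v = k \<cdot>\<^sub>v v"
    using assms by (auto simp: eigenvalue_def eigenvector_def)
  then obtain j where j: "j < n" "v $ j \<noteq> 0" by (metis carrier_vecD eq_vecI index_zero_vec)
  \<comment> \<open>The eigenvalue equation is read at a coordinate \<open>i\<close> of largest
    modulus, where every other coordinate can be bounded by \<open>m\<close> and \<open>m\<close>
    then cancelled.\<close>
  define m where "m = Max ((\<lambda>i. cmod (v $ i)) ` {..<n})"
  have le: "cmod (v $ i) \<le> m" if "i < n" for i
    unfolding m_def using that by (intro Max_ge) auto
  have "m \<in> (\<lambda>i. cmod (v $ i)) ` {..<n}"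
    unfolding m_def using j by (intro Max_in) auto
  then obtain i where i: "i < n" "m = cmod (v $ i)" by auto
  have "0 < m" using le[OF j(1)] j(2) by (metis order_less_le_trans zero_less_norm_iff)
  have "k * v $ i = (A *\<^sub>v v) $ i" using v i by simp
  also have "\<dots> = (\<Sum>j<n. A $$ (i, j) * v $ j)"
    using A v(1) i(1) by (simp add: scalar_prod_def atLeast0LessThan)
  finally have "cmod k * m = cmod (\<Sum>j<n. A $$ (i, j) * v $ j)"
    by (metis i(2) norm_mult)
  also have "\<dots> \<le> (\<Sum>j<n. cmod (A $$ (i, j)) * m)"
    by (rule order_trans[OF norm_sum]) (auto simp: norm_mult le intro!: sum_mono mult_left_mono)
  also have "\<dots> \<le> l * m"
    using row[OF i(1)] \<open>0 < m\<close> by (simp flip: sum_distrib_right)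
  finally show ?thesis using \<open>0 < m\<close> by simp
qed

lemma Max_real_eigenvalue_eqI:
  fixes A :: "complex mat"
  assumes A: "A \<in> carrier_mat n n"
    and row: "\<And>i. i < n \<Longrightarrow> (\<Sum>j<n. cmod (A $$ (i, j))) \<le> l"
    and ev: "eigenvalue A (complex_of_real l)"
  shows "Max {x. eigenvalue A (complex_of_real x)} = l"
proof (rule Max_eqI)
  \<comment> \<open>\<open>Max\<close> is meaningful only on a finite set: eigenvalues are roots of
    a nonzero polynomial, and the embedding of the reals is injective.\<close>
  have "char_poly A \<noteq> 0" using degree_monic_char_poly[OF A] by auto
  then have "finite {x. eigenvalue A x}"
    by (simp add: eigenvalue_root_char_poly[OF A] poly_roots_finite)
  then have "finite (complex_of_real -` {x. eigenvalue A x})"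
    by (rule finite_vimageI) (simp add: inj_def)
  then show "finite {x. eigenvalue A (complex_of_real x)}" by (simp add: vimage_def)
  show "x \<le> l" if "x \<in> {x. eigenvalue A (complex_of_real x)}" for x
    using cmod_eigenvalue_le_row_sum[OF A row] that by fastforce
qed (use ev in simp)

lemma sum_nth_eq_sum_set:
  assumes "distinct xs"
  shows "(\<Sum>j<length xs. f (xs ! j)) = (\<Sum>x\<in>set xs. f x)"
  by (rule sum.reindex_bij_betw, rule bij_betw_nth) (simp_all add: assms)

text \<open>The certificate used for both eigenvalues: row sums at most \<open>l\<close>, and a
  vector \<open>w\<close> attaining \<open>l\<close> that is nonzero at \<open>X0\<close>.
  Everything is indexed by orbital lists, so that matrix positions do not appear later.\<close>

lemma lambda_max_eqI:
  fixes Ns M k :: nat and l :: real and w :: "orbital list \<Rightarrow> complex"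
  defines "E \<equiv> \<lambda>X Y. expval Ns (Psi Ns M) (Bdag X \<circ> adj_op Ns (Bdag Y))"
  assumes row: "\<And>X. X \<in> set (orbital_ksets Ns k) \<Longrightarrow>
      (\<Sum>Y\<in>set (orbital_ksets Ns k). cmod (E X Y)) \<le> l"
    and "X0 \<in> set (orbital_ksets Ns k)" "w X0 \<noteq> 0"
    and ev: "\<And>X. X \<in> set (orbital_ksets Ns k) \<Longrightarrow>
      (\<Sum>Y\<in>set (orbital_ksets Ns k). E X Y * w Y) = complex_of_real l * w X"
  shows "lambda_max Ns M k = l"
proof -
  let ?Xs = "orbital_ksets Ns k" and ?A = "density_matrix Ns k (Psi Ns M)"
  define n where "n = length ?Xs"
  have A: "?A \<in> carrier_mat n n"
    by (simp add: density_matrix_def n_def Let_def)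
  have el: "?A $$ (i, j) = E (?Xs ! i) (?Xs ! j)" if "i < n" "j < n" for i j
    using that by (simp add: density_matrix_def n_def Let_def E_def)
  note sum = sum_nth_eq_sum_set[OF distinct_orbital_ksets[of Ns k], folded n_def]
  have mem: "?Xs ! i \<in> set ?Xs" if "i < n" for i using that by (simp add: n_def)
  define v where "v = vec n (\<lambda>i. w (?Xs ! i))"
  have v: "v \<in> carrier_vec n" by (simp add: v_def)
  obtain i where "i < n" "?Xs ! i = X0" using assms(3) by (auto simp: in_set_conv_nth n_def)
  then have "v $ i \<noteq> 0\<^sub>v n $ i" using assms(4) by (simp add: v_def)
  then have "v \<noteq> 0\<^sub>v n" by metis
  moreover have "?A *\<^sub>v v = complex_of_real l \<cdot>\<^sub>v v"
  proof (rule eq_vecI)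
    fix i assume "i < dim_vec (complex_of_real l \<cdot>\<^sub>v v)"
    then have i: "i < n" by (simp add: v_def)
    have "(?A *\<^sub>v v) $ i = (\<Sum>j<n. ?A $$ (i, j) * v $ j)"
      using A v i by (simp add: scalar_prod_def atLeast0LessThan)
    also have "\<dots> = (\<Sum>j<n. E (?Xs ! i) (?Xs ! j) * w (?Xs ! j))"
      using i by (intro sum.cong) (auto simp: el v_def)
    also have "\<dots> = complex_of_real l * w (?Xs ! i)"
      by (simp only: sum[of "\<lambda>Y. E (?Xs ! i) Y * w Y"] ev[OF mem[OF i]])
    finally show "(?A *\<^sub>v v) $ i = (complex_of_real l \<cdot>\<^sub>v v) $ i"
      using i by (simp add: v_def)
  qed (use A v in auto)
  ultimately have "eigenvalue ?A (complex_of_real l)"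
    using A v unfolding eigenvalue_def eigenvector_def by auto
  moreover have "(\<Sum>j<n. cmod (?A $$ (i, j))) \<le> l" if "i < n" for i
  proof -
    have "(\<Sum>j<n. cmod (?A $$ (i, j))) = (\<Sum>j<n. cmod (E (?Xs ! i) (?Xs ! j)))"
      using that by (intro sum.cong) (auto simp: el)
    then show ?thesis using row[OF mem[OF that]] sum[of "\<lambda>Y. cmod (E (?Xs ! i) Y)"] by simp
  qed
  ultimately show ?thesis
    unfolding lambda_max_def by (intro Max_real_eigenvalue_eqI[OF A])
qed

section \<open>The eigenvalues for two and four particles\<close>

lemma expval_Psi_diagonal_eq:
  assumes "distinct X" "set X \<subseteq> orbitals Ns" "fst ` set X = {R}" "M \<le> Ns"
  shows "expval Ns (Psi Ns M) (Bdag X \<circ> adj_op Ns (Bdag X)) = complex_of_real (real M / real Ns)"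
proof -
  have "R < Ns" using assms(2,3) by (force simp: orbitals_def)
  then show ?thesis
    unfolding expval_Psi_diagonal[OF assms(1,2)] assms(3)
      card_cell_subsets_containing[OF \<open>R < Ns\<close> assms(4), symmetric]
    by simp
qed

text \<open>Pick one cell \<open>R\<close> touched by \<open>X\<close>: a cell set containing all
  touched cells contains \<open>R\<close>, so there are no more of them than in the single-cell
  count.\<close>

lemma cmod_expval_Psi_diagonal_le:
  assumes "distinct X" "set X \<subseteq> orbitals Ns" "X \<noteq> []" "M \<le> Ns"
  shows "cmod (expval Ns (Psi Ns M) (Bdag X \<circ> adj_op Ns (Bdag X))) \<le> real M / real Ns"
proof -
  obtain R where R: "R < Ns" "R \<in> fst ` set X"
    using assms(2,3) by (cases X) (auto simp: orbitals_def)
  have "card {A \<in> cell_subsets Ns M. fst ` set X \<subseteq> A} \<le> card {A \<in> cell_subsets Ns M. R \<in> A}"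
    using R by (intro card_mono) auto
  then show ?thesis
    unfolding expval_Psi_diagonal[OF assms(1,2)]
      card_cell_subsets_containing[OF R(1) assms(4), symmetric]
    by (simp add: norm_divide divide_right_mono)
qed

lemma lambda_max_2:
  assumes "0 < Ns" "M \<le> Ns"
  shows "lambda_max Ns M 2 = real M / real Ns"
proof -
  let ?Xs = "set (orbital_ksets Ns 2)"
  let ?E = "\<lambda>X Y. expval Ns (Psi Ns M) (Bdag X \<circ> adj_op Ns (Bdag Y))"
  have off: "?E X Y = 0" if "X \<in> ?Xs" "Y \<in> ?Xs" "X \<noteq> Y" for X Y
  proof (rule expval_Psi_eq_0)
    show "set X \<noteq> set Y" using orbital_ksets_set_eqD that by blast
    show "\<not> (set X = full {R} \<and> set Y = full {R'})" for R R'
      using orbital_ksetsD(1,2)[OF that(1)] distinct_card[of X] by (auto simp: card_full)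
  qed (use that in \<open>auto dest: orbital_ksetsD\<close>)
  \<comment> \<open>Two modes of the same cell: such a pair touches one cell only, so its diagonal
    entry attains the bound. Cell 0 exists because \<open>Ns\<close> is positive.\<close>
  have "{(0, 1), (0, 2)} \<in> {X. X \<subseteq> orbitals Ns \<and> card X = 2}"
    using assms by (auto simp: orbitals_def)
  then have "{(0, 1), (0, 2)} \<in> set ` ?Xs"
    unfolding bij_betw_imp_surj_on[OF bij_betw_orbital_ksets] .
  then obtain X0 where X0: "X0 \<in> ?Xs" "set X0 = {(0, 1), (0, 2)}" by force
  show ?thesis
  proof (rule lambda_max_eqI[where w = "\<lambda>Y. if Y = X0 then 1 else 0"])
    fix X assume X: "X \<in> ?Xs"
    note D = orbital_ksetsD[OF X]
    show "(\<Sum>Y\<in>?Xs. cmod (?E X Y)) \<le> real M / real Ns"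
    proof -
      have "(\<Sum>Y\<in>?Xs. cmod (?E X Y)) = (\<Sum>Y\<in>{X}. cmod (?E X Y))"
        using X off by (intro sum.mono_neutral_right) auto
      moreover have "X \<noteq> []" using D(2) by auto
      ultimately show ?thesis using cmod_expval_Psi_diagonal_le[OF D(1,3)] assms by simp
    qed
    show "(\<Sum>Y\<in>?Xs. ?E X Y * (if Y = X0 then 1 else 0)) =
        complex_of_real (real M / real Ns) * (if X = X0 then 1 else 0)"
    proof -
      have "(\<Sum>Y\<in>?Xs. ?E X Y * (if Y = X0 then 1 else 0)) =
          (\<Sum>Y\<in>{X}. ?E X Y * (if Y = X0 then 1 else 0))"
        using X off by (intro sum.mono_neutral_right) auto
      moreover have "?E X X = complex_of_real (real M / real Ns)" if "X = X0"
        using expval_Psi_diagonal_eq[OF D(1,3), of 0] that X0 assms by simp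
      ultimately show ?thesis by simp
    qed
  qed (use X0 in auto)
qed

lemma lambda_max_4:
  assumes "0 < Ns" "M \<le> Ns"
  shows "lambda_max Ns M 4 = real M * (real Ns - real M + 1) / real Ns"
proof -
  let ?Xs = "set (orbital_ksets Ns 4)"
  let ?E = "\<lambda>X Y. expval Ns (Psi Ns M) (Bdag X \<circ> adj_op Ns (Bdag Y))"
  let ?C = "cell_list ` {..<Ns}"
  define l where "l = real M * (real Ns - real M + 1) / real Ns"
  define d where "d = real M / real Ns"
  define e where "e = real M * (real Ns - real M) / (real Ns * (real Ns - 1))"
  have nonneg: "0 \<le> d" "0 \<le> e" using assms by (auto simp: d_def e_def)
  \<comment> \<open>The row sum of the cell block: one diagonal entry \<open>d\<close> and
    \<open>Ns - 1\<close> entries \<open>e\<close>. For \<open>Ns = 1\<close> the denominator of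
    \<open>e\<close> is 0, which makes \<open>e\<close> equal to 0, and \<open>M\<close> can only be
    0 or 1.\<close>
  have l: "d + (real Ns - 1) * e = l"
  proof (cases "Ns = 1")
    case True
    then have "M = 0 \<or> M = 1" using assms by linarith
    with True show ?thesis by (auto simp: d_def e_def l_def)
  next
    case False
    then have "real Ns - 1 \<noteq> 0" "real Ns \<noteq> 0" using assms by auto
    then show ?thesis by (simp add: d_def e_def l_def divide_simps) (simp add: algebra_simps)
  qed
  have "d \<le> l" using nonneg assms by (simp flip: l)
  have CX: "?C \<subseteq> ?Xs" using cell_list_in_orbital_ksets by auto
  have off: "?E X Y = 0" if "X \<in> ?Xs" "Y \<in> ?Xs" "X \<noteq> Y" "X \<notin> ?C \<or> Y \<notin> ?C" for X Y
  proof (rule expval_Psi_eq_0)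
    show "set X \<noteq> set Y" using orbital_ksets_set_eqD that by blast
    show "\<not> (set X = full {R} \<and> set Y = full {R'})" if "R < Ns" "R' < Ns" for R R'
      using orbital_ksets_eq_cell_list \<open>X \<in> ?Xs\<close> \<open>Y \<in> ?Xs\<close> \<open>X \<notin> ?C \<or> Y \<notin> ?C\<close> that by blast
  qed (use that in \<open>auto dest: orbital_ksetsD\<close>)
  have cells: "?E (cell_list R) (cell_list R') = complex_of_real (if R' = R then d else e)"
    if "R < Ns" "R' < Ns" for R R'
  proof (cases "R' = R")
    case True
    have "fst ` full {R} = {R}" by (force simp: full_def)
    then show ?thesis
      using True that assms expval_Psi_diagonal_eq[of "cell_list R" Ns R M] by (simp add: d_def)
  next
    case False
    then show ?thesis using that assms expval_Psi_cells[of R Ns R' M] by (simp add: e_def)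
  qed
  have row_sum: "(\<Sum>R'<Ns. if R' = R then d else e) = l" if "R < Ns" for R
  proof -
    have "(\<Sum>R'<Ns. if R' = R then d else e) = d + (\<Sum>R'\<in>{..<Ns} - {R}. e)"
      using that by (simp add: sum.remove[of _ R])
    also have "\<dots> = l" using that l by (simp add: of_nat_diff)
    finally show ?thesis .
  qed
  \<comment> \<open>Polymorphic in the value type, since it serves the real row sums as well as the
    complex eigenvector equation.\<close>
  have to_cells: "(\<Sum>Y\<in>?Xs. f Y) = (\<Sum>R'<Ns. f (cell_list R'))"
    if "\<And>Y. Y \<in> ?Xs - ?C \<Longrightarrow> f Y = 0" for f :: "orbital list \<Rightarrow> 'b :: comm_monoid_add"
  proof -
    have "(\<Sum>Y\<in>?Xs. f Y) = (\<Sum>Y\<in>?C. f Y)"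
      using that CX by (intro sum.mono_neutral_right) auto
    then show ?thesis by (simp add: sum.reindex[OF inj_cell_list])
  qed
  have "lambda_max Ns M 4 = l"
  \<comment> \<open>The indicator of the cells is an eigenvector because all rows of the cell block
    have the same sum \<open>l\<close> and the block does not couple to other lists.\<close>
  proof (rule lambda_max_eqI[where w = "\<lambda>Y. if Y \<in> ?C then 1 else 0"])
    fix X assume X: "X \<in> ?Xs"
    note D = orbital_ksetsD[OF X]
    show "(\<Sum>Y\<in>?Xs. cmod (?E X Y)) \<le> l"
    proof (cases "X \<in> ?C")
      case True
      then obtain R where R: "R < Ns" "X = cell_list R" by auto
      have "(\<Sum>Y\<in>?Xs. cmod (?E X Y)) = (\<Sum>R'<Ns. cmod (?E X (cell_list R')))"
        using True X off by (intro to_cells) auto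
      also have "\<dots> = (\<Sum>R'<Ns. if R' = R then d else e)"
        using R cells nonneg by (intro sum.cong) auto
      finally show ?thesis using row_sum R by simp
    next
      case False
      then have "(\<Sum>Y\<in>?Xs. cmod (?E X Y)) = (\<Sum>Y\<in>{X}. cmod (?E X Y))"
        using X off by (intro sum.mono_neutral_right) auto
      moreover have "X \<noteq> []" using D(2) by auto
      ultimately show ?thesis
        \<comment> \<open>Off the cell block a row has only its diagonal entry, at most
          \<open>d\<close>, and \<open>d\<close> is at most \<open>l\<close> because
          \<open>e\<close> is nonnegative.\<close>
        using cmod_expval_Psi_diagonal_le[OF D(1,3) _ assms(2)] \<open>d \<le> l\<close> by (simp add: d_def)
    qed
    show "(\<Sum>Y\<in>?Xs. ?E X Y * (if Y \<in> ?C then 1 else 0)) =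
        complex_of_real l * (if X \<in> ?C then 1 else 0)"
    proof (cases "X \<in> ?C")
      case True
      then obtain R where R: "R < Ns" "X = cell_list R" by auto
      have "(\<Sum>Y\<in>?Xs. ?E X Y * (if Y \<in> ?C then 1 else 0)) = (\<Sum>R'<Ns. ?E X (cell_list R'))"
        by (subst to_cells) auto
      also have "\<dots> = (\<Sum>R'<Ns. complex_of_real (if R' = R then d else e))"
        using R cells by (intro sum.cong) auto
      also have "\<dots> = complex_of_real l"
        unfolding of_real_sum[symmetric] row_sum[OF R(1)] ..
      finally show ?thesis using True by simp
    next
      case False
      then have "(\<Sum>Y\<in>?Xs. ?E X Y * (if Y \<in> ?C then 1 else 0)) = 0"
        using X off by (intro sum.neutral) auto
      then show ?thesis using False by simp
    qed
  qed (use CX assms in auto)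
  then show ?thesis by (simp add: l_def)
qed

section \<open>Pair correlators and the limit of many cells\<close>

lemma expval_Psi_pairs:
  assumes "R \<noteq> R'" "a \<noteq> b" "c \<noteq> d"
  shows "expval Ns (Psi Ns M) (Pdag R a b \<circ> Pann Ns R' c d) = 0"
proof -
  have card: "card {(R, a), (R, b)} = 2" using assms by simp
  \<comment> \<open>Two orbitals never fill a cell, and the pairs in \<open>R\<close> and
    \<open>R'\<close> differ as sets, so the vanishing criterion applies.\<close>
  have "{(R, a), (R, b)} \<noteq> full {S}" for S
  proof
    assume "{(R, a), (R, b)} = full {S}"
    then have "card {(R, a), (R, b)} = 4" by (simp add: card_full)
    with card show False by simp
  qed
  then show ?thesis
    unfolding Pann_def Pdag_eq_Bdag using assms by (intro expval_Psi_eq_0) auto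
qed

lemma lambda_max_limits:
  fixes \<nu> :: real and Ns M :: "nat \<Rightarrow> nat"
  assumes \<nu>: "0 < \<nu>" "\<nu> < 1" and filling: "\<And>n. real (M n) / real (Ns n) = \<nu>"
    and lim: "filterlim Ns at_top sequentially"
  shows "(\<lambda>n. lambda_max (Ns n) (M n) 4 / real (Ns n)) \<longlonglongrightarrow> \<nu> * (1 - \<nu>)"
    and "(\<lambda>n. lambda_max (Ns n) (M n) 2 / real (Ns n)) \<longlonglongrightarrow> 0"
proof -
  \<comment> \<open>With \<open>Ns n = 0\<close> the quotient would be 0 by the convention for
    division, against \<open>0 < \<nu>\<close>; hence the exact formulas hold for every
    \<open>n\<close>.\<close>
  have pos: "0 < Ns n" for n
    using filling[of n] \<nu> by (cases "Ns n = 0") auto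
  have M: "real (M n) = \<nu> * real (Ns n)" for n
    using filling[of n] pos[of n] by (simp add: field_simps)
  have le: "M n \<le> Ns n" for n
    using M[of n] \<nu> mult_right_mono[of \<nu> 1 "real (Ns n)"] by simp
  have inv: "(\<lambda>n. 1 / real (Ns n)) \<longlonglongrightarrow> 0"
    using filterlim_compose[OF lim_1_over_n lim] by simp
  \<comment> \<open>Substituting \<open>M n = \<nu> * Ns n\<close> leaves \<open>1 / Ns n\<close> as
    the only quantity varying with \<open>n\<close>.\<close>
  have "lambda_max (Ns n) (M n) 4 / real (Ns n) = \<nu> * (1 - \<nu> + 1 / real (Ns n))" for n
    using pos[of n] by (simp add: lambda_max_4 le M field_simps)
  moreover have "(\<lambda>n. \<nu> * (1 - \<nu> + 1 / real (Ns n))) \<longlonglongrightarrow> \<nu> * (1 - \<nu> + 0)"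
    by (intro tendsto_intros inv)
  ultimately show "(\<lambda>n. lambda_max (Ns n) (M n) 4 / real (Ns n)) \<longlonglongrightarrow> \<nu> * (1 - \<nu>)"
    by simp
  have "lambda_max (Ns n) (M n) 2 / real (Ns n) = \<nu> * (1 / real (Ns n))" for n
    using pos[of n] by (simp add: lambda_max_2 le M)
  moreover have "(\<lambda>n. \<nu> * (1 / real (Ns n))) \<longlonglongrightarrow> \<nu> * 0"
    by (intro tendsto_intros inv)
  ultimately show "(\<lambda>n. lambda_max (Ns n) (M n) 2 / real (Ns n)) \<longlonglongrightarrow> 0"
    by (simp only: mult_zero_right)
qed

theorem mainTheorem6:
  shows
    "(\<forall>Ns M :: nat. 0 < Ns \<and> M \<le> Ns \<longrightarrow>
        lambda_max Ns M 4 = real M * (real Ns - real M + 1) / real Ns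
      \<and> lambda_max Ns M 2 = real M / real Ns
      \<and> (\<forall>R<Ns. \<forall>R'<Ns. R \<noteq> R' \<longrightarrow>
            expval Ns (Psi Ns M) (qdag R \<circ> qann Ns R')
              = complex_of_real (real M * (real Ns - real M) / (real Ns * (real Ns - 1)))
          \<and> (\<forall>a b c d. 1 \<le> a \<and> a < b \<and> b \<le> 4 \<and> 1 \<le> c \<and> c < d \<and> d \<le> 4 \<longrightarrow>
                expval Ns (Psi Ns M) (Pdag R a b \<circ> Pann Ns R' c d) = 0)))
   \<and> (\<forall>(\<nu> :: real) (Ns :: nat \<Rightarrow> nat) (M :: nat \<Rightarrow> nat).
        0 < \<nu> \<and> \<nu> < 1 \<and> (\<forall>n. real (M n) / real (Ns n) = \<nu>)
          \<and> filterlim Ns at_top sequentially \<longrightarrow>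
        (\<lambda>n. lambda_max (Ns n) (M n) 4 / real (Ns n)) \<longlonglongrightarrow> \<nu> * (1 - \<nu>)
      \<and> \<nu> * (1 - \<nu>) > 0
      \<and> (\<lambda>n. lambda_max (Ns n) (M n) 2 / real (Ns n)) \<longlonglongrightarrow> 0)"
proof (intro conjI allI impI; (elim conjE)?)
  fix Ns M R R' :: nat
  assume "M \<le> Ns" "R < Ns" "R' < Ns" "R \<noteq> R'"
  then show "expval Ns (Psi Ns M) (qdag R \<circ> qann Ns R')
      = complex_of_real (real M * (real Ns - real M) / (real Ns * (real Ns - 1)))"
    unfolding qann_def qdag_eq_Bdag by (intro expval_Psi_cells)
qed (simp_all add: lambda_max_2 lambda_max_4 lambda_max_limits expval_Psi_pairs)

end
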